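(* Let $\bar{\mathbf x},\bar{\mathbf y}\in\mathbb{P}(\mathbb{Z})$ be distinct and non-adjacent, and let $r,l,A_r,B_l,\bar{\mathbf e}_1,\bar{\mathbf f}_1$ be produced by the transition algorithm for $\bar{\mathbf x},\bar{\mathbf y}$ (see context). 1. For each of the two equivalence classes $C$ of $\sim_{\{\bar{\mathbf x},\bar{\mathbf y}\}}$ there is a unique shortest path from $\bar{\mathbf x}$ to $\bar{\mathbf y}$ in $G$ all of whose vertices other than $\bar{\mathbf x},\bar{\mathbf y}$ lie in $C$. Its length is $d_a(\bar{\mathbf x},\bar{\mathbf y})=1+A_r$ if $C$ is the class containing $\bar{\mathbf e}_1$, and $d_b(\bar{\mathbf x},\bar{\mathbf y})=1+B_l$ if $C$ is the class containing $\bar{\mathbf f}_1$. In particular, the distant graph $G$ is connected. 2. There are at most two shortest consistent paths connecting $\bar{\mathbf x}$ and $\bar{\mathbf y}$ in $G$. 3. There is a unique shortest consistent path connecting $\bar{\mathbf x}$ and $\bar{\mathbf y}$ if and only if $d_a(\bar{\mathbf x},\bar{\mathbf y})\neq d_b(\bar{\mathbf x},\bar{\mathbf y})$.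
   Context: **Projective line and distant graph.** The points of $\mathbb{P}(\mathbb{Z})$ are the cyclic submodules $\bar{\mathbf v}=\mathbb{Z}\mathbf v\subset\mathbb{Z}^2$, where $\mathbf v=(a,b)\in\mathbb{Z}^2$ is unimodular, i.e. $\gcd(a,b)=1$. A point determines its generator up to sign; such a generator is called a representative. Two points $\bar{\mathbf x},\bar{\mathbf y}$ are adjacent (distant), written $\bar{\mathbf x}\,\Delta\,\bar{\mathbf y}$, if $\det[\mathbf x,\mathbf y]=\pm1$; here $[\mathbf x,\mathbf y]$ is the matrix with columns $\mathbf x,\mathbf y$. The distant graph $G$ has vertex set $\mathbb{P}(\mathbb{Z})$ and edges the pairs of adjacent points. A path is a sequence of distinct vertices with consecutive ones adjacent, and its length is its number of edges. **Cone relation.** Let $\bar{\mathbf x}\ne\bar{\mathbf y}$ have representatives $\mathbf x,\mathbf y$. Every point $\bar{\mathbf u}\notin\{\bar{\mathbf x},\bar{\mathbf y}\}$ has a representative $\mathbf u=\alpha\mathbf x+\beta\mathbf y$ with real $\alpha,\beta\ne0$. Write $\mathbf v=\alpha'\mathbf x+\beta'\mathbf y$ for a representative of another such point $\bar{\mathbf v}$. Then $\bar{\mathbf u}\sim_{\{\bar{\mathbf x},\bar{\mathbf y}\}}\bar{\mathbf v}$ means that $\alpha\beta$ and $\alpha'\beta'$ have the same sign. This is an equivalence relation on $\mathbb{P}(\mathbb{Z})\setminus\{\bar{\mathbf x},\bar{\mathbf y}\}$ with exactly two classes: the points represented in the open cone $\{\alpha\beta>0\}$ and those represented in $\{\alpha\beta<0\}$.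 **Consistent paths.** A path from $\bar{\mathbf x}$ to $\bar{\mathbf y}$ is consistent if all its vertices other than $\bar{\mathbf x},\bar{\mathbf y}$ lie in one equivalence class of $\sim_{\{\bar{\mathbf x},\bar{\mathbf y}\}}$. **Transition algorithm** (for distinct non-adjacent $\bar{\mathbf x},\bar{\mathbf y}$, with fixed representatives $\mathbf x,\mathbf y$). - Put $P=\{\alpha\mathbf x+\beta\mathbf y:\alpha>0,\beta>0\}$ and $N=\{\alpha\mathbf x+\beta\mathbf y:\alpha<0,\beta>0\}$. - The integer vectors $\mathbf c$ with $|\det[\mathbf x,\mathbf c]|=1$ and $\beta>0$ form a sequence $\mathbf c_n=\mathbf c_0-n\mathbf x$, $n\in\mathbb{Z}$. There is a unique $n$ with $\mathbf u:=\mathbf c_n\in P$ and $\mathbf w:=\mathbf c_{n+1}\in N$. - If $\mathbf u+\mathbf w=\mathbf y$, put $\mathbf e_1=\mathbf u$, $\mathbf f_1=\mathbf w$, $r=l=0$, and stop. - Otherwise let $Q_e$ be the one of $P,N$ containing $\mathbf u+\mathbf w$ and $Q_f$ the other. Let $\mathbf e_1$ be the one of $\mathbf u,\mathbf w$ lying in $Q_e$, and $\mathbf f_1$ the other. - Start with the lists $(\mathbf e_1)$ and $(\mathbf f_1)$ and repeat the following. Let $\mathbf e,\mathbf f$ be the last entries of the lists and $\mathbf s=\mathbf e+\mathbf f$. If $\mathbf s=\mathbf y$, stop. If $\mathbf s\in Q_e$, append $\mathbf s$ to the e-list (an E-step). Otherwise $\mathbf s\in Q_f$, and append $\mathbf s$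 to the f-list (an F-step). - This always terminates. The word of steps has the form $E^{a_1}F^{b_1}E^{a_2}F^{b_2}\cdots$ with all exponents $\ge1$. Let $r$ be the number of E-blocks and $l$ the number of F-blocks, so $r-l\in\{0,1\}$. - Put $a_0=b_0=a_{r+1}=b_{l+1}=1$, $A_k=\sum_{n=0}^k a_n$ and $B_k=\sum_{n=0}^k b_n$. Then the e-list is $(\mathbf e_1,\dots,\mathbf e_{A_r})$ and the f-list is $(\mathbf f_1,\dots,\mathbf f_{B_l})$. - Write $\bar{\mathbf e}_i,\bar{\mathbf f}_j$ for the corresponding points. *)

theory Defs
  imports
    "HOL-Analysis.Determinants"
    "HOL-Library.While_Combinator"
    "Graph_Theory.Digraph_Component"
    "Graph_Theory.Vertex_Walk"
begin

section \<open>The projective line over the integers and its distant graph\<close>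

definition unimodular :: "int ^ 2 \<Rightarrow> bool" where
  "unimodular v \<longleftrightarrow> gcd (v $ 1) (v $ 2) = 1"

definition cyclic_submodule :: "int ^ 2 \<Rightarrow> (int ^ 2) set" where
  "cyclic_submodule v = range (\<lambda>k::int. k *s v)"

definition proj_line :: "(int ^ 2) set set" where
  "proj_line = cyclic_submodule ` {v. unimodular v}"

definition reps :: "(int ^ 2) set \<Rightarrow> (int ^ 2) set" where
  "reps X = {v. unimodular v \<and> cyclic_submodule v = X}"

text \<open>\<^const>\<open>vector\<close> lists the rows of a matrix, so the transpose has columns \<open>x\<close>, \<open>y\<close>.\<close>

definition det_cols :: "int ^ 2 \<Rightarrow> int ^ 2 \<Rightarrow> int" where
  "det_cols x y = det (transpose (vector [x, y] :: int ^ 2 ^ 2))"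

definition distant :: "(int ^ 2) set \<Rightarrow> (int ^ 2) set \<Rightarrow> bool" where
  "distant X Y \<longleftrightarrow> (\<exists>x\<in>reps X. \<exists>y\<in>reps Y. \<bar>det_cols x y\<bar> = 1)"

text \<open>
  The undirected distant graph, as a symmetric digraph whose arcs are the ordered pairs of
  adjacent points. Its paths are the vertex lists satisfying \<^const>\<open>vpath\<close>.
\<close>

definition distant_graph :: "((int ^ 2) set, (int ^ 2) set \<times> (int ^ 2) set) pre_digraph" where
  "distant_graph = with_proj
     \<lparr> pverts = proj_line, parcs = {(X, Y). X \<in> proj_line \<and> Y \<in> proj_line \<and> distant X Y} \<rparr>"

section \<open>The cone relation and consistent paths\<close>

definition real_vec :: "int ^ 2 \<Rightarrow> real ^ 2" where
  "real_vec v = (\<chi> i. real_of_int (v $ i))"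

text \<open>
  Changing the sign of \<open>u\<close> or \<open>v\<close> leaves both products below unchanged, and changing the sign
  of \<open>x\<close> or \<open>y\<close> negates both of them; so the choice of representatives is immaterial.
\<close>

definition cone_rel :: "(int ^ 2) set \<Rightarrow> (int ^ 2) set \<Rightarrow> (int ^ 2) set rel" where
  "cone_rel X Y = {(U, V). U \<in> proj_line - {X, Y} \<and> V \<in> proj_line - {X, Y} \<and>
     (\<exists>x\<in>reps X. \<exists>y\<in>reps Y. \<exists>u\<in>reps U. \<exists>v\<in>reps V. \<exists>\<alpha> \<beta> \<alpha>' \<beta>' :: real.
        \<alpha> \<noteq> 0 \<and> \<beta> \<noteq> 0 \<and> \<alpha>' \<noteq> 0 \<and> \<beta>' \<noteq> 0 \<and>
        real_vec u = \<alpha> *\<^sub>R real_vec x + \<beta> *\<^sub>R real_vec y \<and>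
        real_vec v = \<alpha>' *\<^sub>R real_vec x + \<beta>' *\<^sub>R real_vec y \<and>
        sgn (\<alpha> * \<beta>) = sgn (\<alpha>' * \<beta>'))}"

definition cone_classes :: "(int ^ 2) set \<Rightarrow> (int ^ 2) set \<Rightarrow> (int ^ 2) set set set" where
  "cone_classes X Y = (proj_line - {X, Y}) // cone_rel X Y"

definition paths_between :: "(int ^ 2) set \<Rightarrow> (int ^ 2) set \<Rightarrow> (int ^ 2) set vwalk set" where
  "paths_between X Y = {p. vpath p distant_graph \<and> hd p = X \<and> last p = Y}"

definition class_paths ::
    "(int ^ 2) set set \<Rightarrow> (int ^ 2) set \<Rightarrow> (int ^ 2) set \<Rightarrow> (int ^ 2) set vwalk set" where
  "class_paths C X Y = {p \<in> paths_between X Y. set p - {X, Y} \<subseteq> C}"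

definition consistent_paths :: "(int ^ 2) set \<Rightarrow> (int ^ 2) set \<Rightarrow> (int ^ 2) set vwalk set" where
  "consistent_paths X Y = {p \<in> paths_between X Y. \<exists>C\<in>cone_classes X Y. set p - {X, Y} \<subseteq> C}"

definition shortest :: "'a vwalk set \<Rightarrow> 'a vwalk set" where
  "shortest S = {p \<in> S. \<forall>q\<in>S. vwalk_length p \<le> vwalk_length q}"

definition class_dist :: "(int ^ 2) set set \<Rightarrow> (int ^ 2) set \<Rightarrow> (int ^ 2) set \<Rightarrow> nat" where
  "class_dist C X Y = Inf (vwalk_length ` class_paths C X Y)"

section \<open>The transition algorithm\<close>

definition cone_P :: "int ^ 2 \<Rightarrow> int ^ 2 \<Rightarrow> (real ^ 2) set" where
  "cone_P x y = {\<alpha> *\<^sub>R real_vec x + \<beta> *\<^sub>R real_vec y | \<alpha> \<beta>. \<alpha> > 0 \<and> \<beta> > 0}"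

definition cone_N :: "int ^ 2 \<Rightarrow> int ^ 2 \<Rightarrow> (real ^ 2) set" where
  "cone_N x y = {\<alpha> *\<^sub>R real_vec x + \<beta> *\<^sub>R real_vec y | \<alpha> \<beta>. \<alpha> < 0 \<and> \<beta> > 0}"

text \<open>
  The vectors \<open>c\<^sub>n = c\<^sub>0 - n x\<close>. Consecutive ones are those that differ by \<open>x\<close>, so the pair
  \<open>(c\<^sub>n, c\<^sub>n\<^sub>+\<^sub>1)\<close> is \<open>(u, u - x)\<close> and the index \<open>n\<close> need not be mentioned.
\<close>

definition start_candidates :: "int ^ 2 \<Rightarrow> int ^ 2 \<Rightarrow> (int ^ 2) set" where
  "start_candidates x y = {c. \<bar>det_cols x c\<bar> = 1 \<and>
     (\<exists>\<alpha> \<beta>. real_vec c = \<alpha> *\<^sub>R real_vec x + \<beta> *\<^sub>R real_vec y \<and> \<beta> > 0)}"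

definition start_u :: "int ^ 2 \<Rightarrow> int ^ 2 \<Rightarrow> int ^ 2" where
  "start_u x y = (THE u. u \<in> start_candidates x y \<and> u - x \<in> start_candidates x y \<and>
     real_vec u \<in> cone_P x y \<and> real_vec (u - x) \<in> cone_N x y)"

definition start_w :: "int ^ 2 \<Rightarrow> int ^ 2 \<Rightarrow> int ^ 2" where
  "start_w x y = start_u x y - x"

text \<open>
  If \<open>u + w = y\<close>, then \<open>u + w\<close> lies in neither cone, and \<open>Q\<^sub>e\<close> is irrelevant because the loop
  below stops at once.
\<close>

definition cone_Qe :: "int ^ 2 \<Rightarrow> int ^ 2 \<Rightarrow> (real ^ 2) set" where
  "cone_Qe x y =
     (if real_vec (start_u x y + start_w x y) \<in> cone_P x y then cone_P x y else cone_N x y)"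

definition first_e :: "int ^ 2 \<Rightarrow> int ^ 2 \<Rightarrow> int ^ 2" where
  "first_e x y =
     (if start_u x y + start_w x y = y \<or> real_vec (start_u x y) \<in> cone_Qe x y
      then start_u x y else start_w x y)"

definition first_f :: "int ^ 2 \<Rightarrow> int ^ 2 \<Rightarrow> int ^ 2" where
  "first_f x y =
     (if start_u x y + start_w x y = y \<or> real_vec (start_u x y) \<in> cone_Qe x y
      then start_w x y else start_u x y)"

datatype step = EStep | FStep

text \<open>A state consists of the e-list, the f-list and the word of the steps made so far.\<close>

type_synonym transition_state = "(int ^ 2) list \<times> (int ^ 2) list \<times> step list"

definition transition_step :: "int ^ 2 \<Rightarrow> int ^ 2 \<Rightarrow> transition_state \<Rightarrow> transition_state" where
  "transition_step x y = (\<lambda>(es, fs, w).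
     let s = last es + last fs in
     if real_vec s \<in> cone_Qe x y then (es @ [s], fs, w @ [EStep])
     else (es, fs @ [s], w @ [FStep]))"

definition transition_run :: "int ^ 2 \<Rightarrow> int ^ 2 \<Rightarrow> transition_state option" where
  "transition_run x y =
     while_option (\<lambda>(es, fs, w). last es + last fs \<noteq> y) (transition_step x y)
       ([first_e x y], [first_f x y], [])"

definition transition_word :: "int ^ 2 \<Rightarrow> int ^ 2 \<Rightarrow> step list" where
  "transition_word x y = snd (snd (the (transition_run x y)))"

text \<open>The maximal constant blocks of a word, from left to right.\<close>

function blocks :: "'a list \<Rightarrow> 'a list list" where
  "blocks [] = []"
| "blocks (a # w) = (a # takeWhile (\<lambda>b. b = a) w) # blocks (dropWhile (\<lambda>b. b = a) w)"
  by pat_completeness auto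
termination
  by (relation "measure length") (auto simp: less_Suc_eq_le length_dropWhile_le)

definition block_lengths :: "step \<Rightarrow> step list \<Rightarrow> nat list" where
  "block_lengths t w = map length (filter (\<lambda>b. hd b = t) (blocks w))"

definition num_blocks :: "step \<Rightarrow> step list \<Rightarrow> nat" where
  "num_blocks t w = length (block_lengths t w)"

text \<open>
  For \<open>t = EStep\<close> these are \<open>a\<^sub>n\<close> and \<open>A\<^sub>k\<close>, for \<open>t = FStep\<close> they are \<open>b\<^sub>n\<close> and \<open>B\<^sub>k\<close>; the value
  \<open>1\<close> outside the blocks covers \<open>a\<^sub>0 = b\<^sub>0 = 1\<close> and \<open>a\<^sub>r\<^sub>+\<^sub>1 = b\<^sub>l\<^sub>+\<^sub>1 = 1\<close>.
\<close>

definition exponent :: "step \<Rightarrow> step list \<Rightarrow> nat \<Rightarrow> nat" where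
  "exponent t w n = (if 1 \<le> n \<and> n \<le> num_blocks t w then block_lengths t w ! (n - 1) else 1)"

definition exponent_sum :: "step \<Rightarrow> step list \<Rightarrow> nat \<Rightarrow> nat" where
  "exponent_sum t w k = (\<Sum>n=0..k. exponent t w n)"

definition transition_Ar :: "int ^ 2 \<Rightarrow> int ^ 2 \<Rightarrow> nat" where
  "transition_Ar x y =
     (let w = transition_word x y in exponent_sum EStep w (num_blocks EStep w))"

definition transition_Bl :: "int ^ 2 \<Rightarrow> int ^ 2 \<Rightarrow> nat" where
  "transition_Bl x y =
     (let w = transition_word x y in exponent_sum FStep w (num_blocks FStep w))"

end

theory Submission
  imports Defs
begin

text \<open>
  The distant graph is the Farey graph, whose edges do not cross: if \<open>e\<close>, \<open>f\<close> is a basis of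
  \<open>\<int>\<^sup>2\<close>, then no edge joins a vector whose coordinates in this basis have equal signs to one whose
  coordinates have opposite signs. In the transition algorithm an entry \<open>e\<close> of one list is followed
  by \<open>e + f\<close> (or the algorithm stops at \<open>y = e + f\<close>), where \<open>f\<close> is an entry of the other list
  adjacent to \<open>e\<close>. The coordinates of \<open>x\<close> have opposite signs and those of \<open>e + f\<close> are equal, so a
  walk from \<open>x\<close> to \<open>e + f\<close> meets \<open>e\<close> or \<open>f\<close>, and it meets \<open>e\<close> if it stays in the class of \<open>e\<close>,
  as \<open>f\<close> lies in the other one. Hence a path from \<open>x\<close> to \<open>y\<close> in one class visits all entries of the
  corresponding list, and the list itself is the unique shortest such path. The algorithm terminates
  because the \<open>y\<close>-coordinate of \<open>e + f\<close> grows and stays bounded by that of \<open>y\<close>.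
\<close>

subsection \<open>Points and edges of the distant graph\<close>

lemma det_cols_eq: "det_cols x y = x $ 1 * y $ 2 - x $ 2 * y $ 1"
  by (simp add: det_cols_def det_2 transpose_def algebra_simps)

lemma det_cols_simps [simp]:
  "det_cols (u + v) w = det_cols u w + det_cols v w"
  "det_cols u (v + w) = det_cols u v + det_cols u w"
  "det_cols (u - v) w = det_cols u w - det_cols v w"
  "det_cols u (v - w) = det_cols u v - det_cols u w"
  "det_cols (- u) w = - det_cols u w"
  "det_cols u (- w) = - det_cols u w"
  "det_cols (k *s u) w = k * det_cols u w"
  "det_cols u (k *s w) = k * det_cols u w"
  "det_cols u u = 0"
  by (simp_all add: det_cols_eq algebra_simps)

lemma det_cols_swap: "det_cols u v = - det_cols v u"
  by (simp add: det_cols_eq algebra_simps)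

lemma abs_det_cols_swap: "\<bar>det_cols u v\<bar> = \<bar>det_cols v u\<bar>"
  by (simp add: det_cols_swap [of u v])

text \<open>The three-term Pluecker relation in the plane. It expresses \<open>det_cols u v\<close>
  by the coordinates of \<open>u\<close> and \<open>v\<close> with respect to \<open>e\<close>,
  \<open>f\<close>, up to the factor \<open>det_cols e f\<close>.\<close>

lemma det_cols_mult_det_cols:
  "det_cols u f * det_cols e v - det_cols v f * det_cols e u = det_cols u v * det_cols e f"
  by (simp add: det_cols_eq algebra_simps)

lemma unimodular_minus [simp]: "unimodular (- v) \<longleftrightarrow> unimodular v"
  by (simp add: unimodular_def)

text \<open>The gcd of the entries of either column divides the determinant.\<close>

lemma unimodular_if_abs_det_cols_eq_1:
  assumes "\<bar>det_cols u v\<bar> = 1"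
  shows "unimodular u" and "unimodular v"
proof -
  have *: "gcd (w $ 1) (w $ 2) dvd det_cols u v" if "w = u \<or> w = v" for w
    using that unfolding det_cols_eq by (elim disjE) (simp_all add: dvd_diff)
  have "gcd (w $ 1) (w $ 2) dvd 1" if "w = u \<or> w = v" for w
    using *[OF that] assms by (metis dvd_abs_iff)
  then show "unimodular u" "unimodular v"
    by (auto simp: unimodular_def)
qed

text \<open>Bezout coefficients of \<open>u\<close> yield an integer \<open>k\<close> with
  \<open>v = k *s u\<close>, and comparing gcds forces \<open>k\<close> to be a unit. Hence a point
  has exactly two generators.\<close>

lemma unimodular_parallel:
  assumes "unimodular u" "unimodular v" "det_cols u v = 0"
  shows "u = v \<or> u = - v"
proof -
  obtain p q where pq: "p * u $ 1 + q * u $ 2 = 1"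
    using bezout_int [of "u $ 1" "u $ 2"] assms(1) by (auto simp: unimodular_def)
  define k where "k = p * v $ 1 + q * v $ 2"
  have det: "u $ 1 * v $ 2 = u $ 2 * v $ 1"
    using assms(3) by (simp add: det_cols_eq)
  have "v $ 1 = k * u $ 1" "v $ 2 = k * u $ 2"
    using pq det unfolding k_def by algebra+
  then have v: "v = k *s u" and "gcd (v $ 1) (v $ 2) = \<bar>k\<bar> * gcd (u $ 1) (u $ 2)"
    by (simp_all add: vec_eq_iff forall_2 gcd_mult_left abs_mult)
  then have "\<bar>k\<bar> = 1"
    using assms by (simp add: unimodular_def)
  then have "k = 1 \<or> k = -1" by linarith
  with v show ?thesis by (auto simp: vec_eq_iff)
qed

lemma mem_cyclic_submodule: "v \<in> cyclic_submodule v"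
  unfolding cyclic_submodule_def by (rule range_eqI [of _ _ 1]) simp

lemma cyclic_submodule_minus [simp]: "cyclic_submodule (- v) = cyclic_submodule v"
proof -
  have "k *s (- v) = (- k) *s v" "k *s v = (- k) *s (- v)" for k
    by (simp_all add: vec_eq_iff)
  then show ?thesis
    unfolding cyclic_submodule_def by (metis (mono_tags, lifting) rangeE rangeI subsetI subset_antisym)
qed

lemma cyclic_submodule_eq_iff:
  assumes "unimodular u" "unimodular v"
  shows "cyclic_submodule u = cyclic_submodule v \<longleftrightarrow> u = v \<or> u = - v"
proof
  assume "cyclic_submodule u = cyclic_submodule v"
  then have "u \<in> cyclic_submodule v"
    using mem_cyclic_submodule by blast
  then have "det_cols u v = 0"
    by (auto simp: cyclic_submodule_def)
  then show "u = v \<or> u = - v"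
    using assms unimodular_parallel by blast
qed auto

lemma mem_reps_iff: "v \<in> reps X \<longleftrightarrow> unimodular v \<and> X = cyclic_submodule v"
  by (auto simp: reps_def)

lemma reps_cyclic_submodule: "unimodular v \<Longrightarrow> reps (cyclic_submodule v) = {v, - v}"
  by (auto simp: reps_def cyclic_submodule_eq_iff)

lemma proj_line_cases:
  assumes "X \<in> proj_line"
  obtains v where "unimodular v" "X = cyclic_submodule v"
  using assms by (auto simp: proj_line_def)

lemma cyclic_submodule_in_proj_line [simp]: "unimodular v \<Longrightarrow> cyclic_submodule v \<in> proj_line"
  by (auto simp: proj_line_def)

lemma distant_cyclic_submodule_iff:
  assumes "unimodular u" "unimodular v"
  shows "distant (cyclic_submodule u) (cyclic_submodule v) \<longleftrightarrow> \<bar>det_cols u v\<bar> = 1"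
  using assms by (simp add: distant_def reps_cyclic_submodule)

lemma verts_distant_graph [simp]: "verts distant_graph = proj_line"
  by (simp add: distant_graph_def)

lemma arcs_ends_distant_graph [simp]:
  "arcs_ends distant_graph = {(X, Y). X \<in> proj_line \<and> Y \<in> proj_line \<and> distant X Y}"
  by (auto simp: distant_graph_def arcs_ends_def arc_to_ends_def)

text \<open>Reduces walks to plain lists, so that the arguments below are inductions on lists or
  indices.\<close>

lemma vwalk_distant_graph_iff:
  "vwalk p distant_graph \<longleftrightarrow> p \<noteq> [] \<and> set p \<subseteq> proj_line \<and> successively distant p"
proof -
  have "set (vwalk_arcs p) \<subseteq> arcs_ends distant_graph \<longleftrightarrow> successively distant p"
    if "set p \<subseteq> proj_line"
    using that by (induction p rule: vwalk_arcs.induct) auto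
  then show ?thesis by (auto simp: vwalk_def)
qed

lemma wf_distant_graph: "wf_digraph distant_graph"
  by unfold_locales (auto simp: distant_graph_def)

lemma class_paths_iff:
  "p \<in> class_paths C X Y \<longleftrightarrow> p \<noteq> [] \<and> set p \<subseteq> proj_line \<and> successively distant p \<and> distinct p \<and>
     hd p = X \<and> last p = Y \<and> set p - {X, Y} \<subseteq> C"
  by (auto simp: class_paths_def paths_between_def vpath_def vwalk_distant_graph_iff)

subsection \<open>Separating edges\<close>

text \<open>The products \<open>p * s\<close> and \<open>r * q\<close> are nonzero integers of
  opposite signs, so in their difference the absolute values add up.\<close>

lemma abs_det_ge_2:
  fixes p q r s :: int
  assumes "p * q < 0" "0 < r * s"
  shows "2 \<le> \<bar>p * s - r * q\<bar>"
proof -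
  have ge: "1 \<le> m * n" if "0 < m" "0 < n" for m n :: int
    using that mult_pos_pos [of m n] by linarith
  consider "0 < p" "q < 0" "0 < r" "0 < s" | "0 < p" "q < 0" "r < 0" "s < 0"
    | "p < 0" "0 < q" "0 < r" "0 < s" | "p < 0" "0 < q" "r < 0" "s < 0"
    using assms by (auto simp: mult_less_0_iff zero_less_mult_iff)
  then show ?thesis
  proof cases
    case 1 then show ?thesis using ge [of p s] ge [of r "- q"] by simp
  next
    case 2 then show ?thesis using ge [of p "- s"] ge [of "- r" "- q"] by simp
  next
    case 3 then show ?thesis using ge [of "- p" s] ge [of r q] by simp
  next
    case 4 then show ?thesis using ge [of "- p" "- s"] ge [of "- r" q] by simp
  qed
qed

text \<open>The coordinates of \<open>u\<close> in the basis \<open>e\<close>, \<open>f\<close> are \<open>det_cols u f\<close> and \<open>det_cols e u\<close>, up to a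
  common sign.\<close>

lemma no_crossing:
  assumes "\<bar>det_cols e f\<bar> = 1" "\<bar>det_cols u v\<bar> = 1" "det_cols u f * det_cols e u < 0"
  shows "det_cols v f * det_cols e v \<le> 0"
proof (rule ccontr)
  assume "\<not> ?thesis"
  then have "2 \<le> \<bar>det_cols u f * det_cols e v - det_cols v f * det_cols e u\<bar>"
    using assms(3) by (intro abs_det_ge_2) auto
  \<comment> \<open>By the Pluecker relation the difference of products is
    \<open>det_cols u v * det_cols e f\<close>, of absolute value 1.\<close>
  then show False
    using assms(1,2) by (simp add: det_cols_mult_det_cols abs_mult)
qed

text \<open>Along a walk avoiding \<open>e\<close> and \<open>f\<close> the product of the two
  coordinates stays negative: it cannot become positive in one step, and it vanishes only at
  \<open>e\<close> and \<open>f\<close>.\<close>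

lemma walk_meets_separating_edge:
  assumes ef: "\<bar>det_cols e f\<bar> = 1"
    and s: "unimodular s" "det_cols s f * det_cols e s < 0"
    and t: "unimodular t" "0 < det_cols t f * det_cols e t"
    and p: "p \<noteq> []" "set p \<subseteq> proj_line" "successively distant p"
      "hd p = cyclic_submodule s" "last p = cyclic_submodule t"
  shows "cyclic_submodule e \<in> set p \<or> cyclic_submodule f \<in> set p"
proof (rule ccontr)
  assume avoid: "\<not> ?thesis"
  note unim = unimodular_if_abs_det_cols_eq_1 [OF ef]
  have "\<exists>v. unimodular v \<and> p ! i = cyclic_submodule v \<and> det_cols v f * det_cols e v < 0"
    if "i < length p" for i
    using that
  proof (induction i)
    case 0
    then show ?case using s p by (auto simp: hd_conv_nth)
  next
    case (Suc i)
    then obtain u where u: "unimodular u" "p ! i = cyclic_submodule u"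
      "det_cols u f * det_cols e u < 0"
      by auto
    obtain v where v: "unimodular v" "p ! Suc i = cyclic_submodule v"
      using Suc.prems p(2) by (meson nth_mem proj_line_cases subsetD)
    have "distant (p ! i) (p ! Suc i)"
      using p(3) Suc.prems by (simp add: successively_nth)
    then have "det_cols v f * det_cols e v \<le> 0"
      using no_crossing [OF ef _ u(3)] u v by (simp add: distant_cyclic_submodule_iff)
    moreover have "v \<noteq> e" "v \<noteq> - e" "v \<noteq> f" "v \<noteq> - f"
      using avoid v(2) Suc.prems by (metis cyclic_submodule_minus nth_mem)+
    then have "det_cols v f \<noteq> 0" "det_cols e v \<noteq> 0"
      using unimodular_parallel [OF v(1) unim(2)] unimodular_parallel [OF unim(1) v(1)] by auto
    ultimately show ?case
      using v by (auto simp: less_le)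
  qed
  from this [of "length p - 1"] obtain v where v: "unimodular v" "last p = cyclic_submodule v"
    "det_cols v f * det_cols e v < 0"
    using p(1) by (auto simp: last_conv_nth)
  \<comment> \<open>Replacing \<open>t\<close> by \<open>- t\<close> negates both coordinates and
    keeps their product.\<close>
  then have "v = t \<or> v = - t"
    using p(5) t(1) cyclic_submodule_eq_iff by metis
  then show False
    using v(3) t(2) by auto
qed

text \<open>Induction on \<open>i\<close>: cut the walk at a visit of \<open>c ! i\<close>. The
  front part is again a walk from \<open>hd c\<close>, now to \<open>c ! i\<close>, and at least one
  vertex follows it. Equality of lengths forces exactly one further vertex and, by induction, the
  front part itself.\<close>

lemma forced_walk:
  assumes forced: "\<And>i q. Suc i < length c \<Longrightarrow> q \<noteq> [] \<Longrightarrow> successively R q \<Longrightarrow> set q \<subseteq> S \<Longrightarrow>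
      hd q = hd c \<Longrightarrow> last q = c ! Suc i \<Longrightarrow> c ! i \<in> set q"
    and "distinct c" "i < length c"
    and "p \<noteq> []" "successively R p" "set p \<subseteq> S" "hd p = hd c" "last p = c ! i"
  shows "i < length p \<and> (length p = Suc i \<longrightarrow> p = take (Suc i) c)"
  using assms(3-)
proof (induction i arbitrary: p)
  case 0
  then show ?case
    by (cases p; cases c) auto
next
  case (Suc i)
  have "c ! i \<in> set p"
    using forced [of i p] Suc.prems by simp
  then obtain q r where p: "p = q @ c ! i # r"
    by (meson split_list)
  \<comment> \<open>Distinctness of \<open>c\<close> makes the remainder \<open>r\<close> nonempty,
    which yields the extra vertex in the count.\<close>
  have "c ! i \<noteq> c ! Suc i"
    using \<open>distinct c\<close> Suc.prems(1) by (simp add: nth_eq_iff_index_eq)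
  then have r: "r \<noteq> []" "last r = c ! Suc i"
    using Suc.prems(6) p by (auto split: if_splits)
  have "i < length (q @ [c ! i]) \<and>
      (length (q @ [c ! i]) = Suc i \<longrightarrow> q @ [c ! i] = take (Suc i) c)"
  proof (rule Suc.IH)
    show "successively R (q @ [c ! i])"
      using Suc.prems(3) unfolding p by (auto simp: successively_append_iff)
    show "hd (q @ [c ! i]) = hd c"
      using Suc.prems(5) unfolding p by (cases q) auto
  qed (use Suc.prems p in auto)
  moreover have "r = [c ! Suc i]" if "length r = 1"
    using that r by (cases r) auto
  moreover have "length r \<ge> 1"
    using r by (cases r) auto
  moreover have "take (Suc (Suc i)) c = take (Suc i) c @ [c ! Suc i]"
    using Suc.prems(1) by (simp add: take_Suc_conv_app_nth)
  ultimately show ?case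
    unfolding p by auto
qed

subsection \<open>Coordinates with respect to two non-adjacent points\<close>

locale nonadjacent_pair =
  fixes x y :: "int ^ 2"
  assumes unimodular_x: "unimodular x" and unimodular_y: "unimodular y"
    and abs_det: "2 \<le> \<bar>det_cols x y\<bar>"
begin

abbreviation X where "X \<equiv> cyclic_submodule x"
abbreviation Y where "Y \<equiv> cyclic_submodule y"

definition D :: int where "D = \<bar>det_cols x y\<bar>"

text \<open>Cramer's rule: \<open>v = (a v / D) x + (b v / D) y\<close>.\<close>

definition a :: "int ^ 2 \<Rightarrow> int" where "a v = sgn (det_cols x y) * det_cols v y"
definition b :: "int ^ 2 \<Rightarrow> int" where "b v = sgn (det_cols x y) * det_cols x v"

lemma D_ge_2: "2 \<le> D"
  using abs_det by (simp add: D_def)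

lemma det_nz: "det_cols x y \<noteq> 0"
  using abs_det by auto

lemma sgn_mult_sgn [simp]: "sgn (det_cols x y) * sgn (det_cols x y) = 1"
  using det_nz by (simp add: sgn_if)

lemma coord_simps [simp]:
  "a (u + v) = a u + a v" "b (u + v) = b u + b v"
  "a (u - v) = a u - a v" "b (u - v) = b u - b v"
  "a (- v) = - a v" "b (- v) = - b v"
  "a (k *s v) = k * a v" "b (k *s v) = k * b v"
  "a x = D" "b x = 0" "a y = 0" "b y = D"
  by (simp_all add: a_def b_def D_def algebra_simps abs_sgn)

lemma abs_b: "\<bar>b v\<bar> = \<bar>det_cols x v\<bar>"
  using det_nz by (simp add: b_def abs_mult)

lemma a_eq_0_iff: "a v = 0 \<longleftrightarrow> det_cols v y = 0"
  and b_eq_0_iff: "b v = 0 \<longleftrightarrow> det_cols x v = 0"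
  using det_nz by (simp_all add: a_def b_def sgn_eq_0_iff)

text \<open>Passing to the coordinates \<open>a\<close>, \<open>b\<close> multiplies determinants by
  \<open>det_cols x y\<close>; the sign factor occurs twice and cancels.\<close>

lemma coord_det: "a u * b v - a v * b u = det_cols x y * det_cols u v"
proof -
  have "a u * b v - a v * b u = (sgn (det_cols x y) * sgn (det_cols x y)) *
      (det_cols u y * det_cols x v - det_cols v y * det_cols x u)"
    unfolding a_def b_def by (simp add: algebra_simps del: sgn_mult_sgn)
  then show ?thesis
    by (simp add: det_cols_mult_det_cols mult.commute)
qed

text \<open>The sign factor in \<open>a\<close> and \<open>b\<close> makes the common denominator
  \<open>D\<close> positive, so every condition on real cone coordinates becomes a sign condition on
  the integers \<open>a v\<close> and \<open>b v\<close>.\<close>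

lemma real_vec_eq_iff:
  "real_vec v = \<alpha> *\<^sub>R real_vec x + \<beta> *\<^sub>R real_vec y \<longleftrightarrow> real_of_int (a v) = \<alpha> * D \<and> real_of_int (b v) = \<beta> * D"
proof -
  define s where "s = real_of_int (sgn (det_cols x y))"
  have s: "s * s = 1"
    unfolding s_def by (metis of_int_1 of_int_mult sgn_mult_sgn)
  have D: "real_of_int D = s * (real_of_int (x $ 1) * y $ 2 - x $ 2 * y $ 1)"
    unfolding s_def D_def abs_sgn by (simp add: det_cols_eq mult.commute)
  have av: "real_of_int (a v) = s * (real_of_int (v $ 1) * y $ 2 - v $ 2 * y $ 1)"
    and bv: "real_of_int (b v) = s * (real_of_int (x $ 1) * v $ 2 - x $ 2 * v $ 1)"
    unfolding s_def a_def b_def by (simp_all add: det_cols_eq)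
  have nz: "real_of_int (x $ 1) * y $ 2 - x $ 2 * y $ 1 \<noteq> 0"
    using D D_ge_2 by auto
  have eq: "real_vec v = \<alpha> *\<^sub>R real_vec x + \<beta> *\<^sub>R real_vec y \<longleftrightarrow>
      real_of_int (v $ 1) = \<alpha> * x $ 1 + \<beta> * y $ 1 \<and> real_of_int (v $ 2) = \<alpha> * x $ 2 + \<beta> * y $ 2"
    by (simp add: real_vec_def vec_eq_iff forall_2)
  show ?thesis
  proof
    assume "real_vec v = \<alpha> *\<^sub>R real_vec x + \<beta> *\<^sub>R real_vec y"
    then show "real_of_int (a v) = \<alpha> * D \<and> real_of_int (b v) = \<beta> * D"
      unfolding eq av bv D by (simp add: algebra_simps)
  next
    assume *: "real_of_int (a v) = \<alpha> * D \<and> real_of_int (b v) = \<beta> * D"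
    \<comment> \<open>Cramer's rule cleared of denominators.\<close>
    have "s * real_of_int D * v $ 1 = s * (a v * x $ 1 + b v * y $ 1)"
      "s * real_of_int D * v $ 2 = s * (a v * x $ 2 + b v * y $ 2)"
      unfolding of_int_mult of_int_add of_int_diff av bv D by algebra+
    then have "s * real_of_int D * v $ 1 = s * real_of_int D * (\<alpha> * x $ 1 + \<beta> * y $ 1)"
      "s * real_of_int D * v $ 2 = s * real_of_int D * (\<alpha> * x $ 2 + \<beta> * y $ 2)"
      using * by (simp_all add: algebra_simps)
    moreover have "s * real_of_int D \<noteq> 0"
      using s D_ge_2 by auto
    ultimately show "real_vec v = \<alpha> *\<^sub>R real_vec x + \<beta> *\<^sub>R real_vec y"
      unfolding eq by (metis mult_left_cancel)
  qed
qed

lemma real_vec_expansion: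
  "real_vec v = (a v / D) *\<^sub>R real_vec x + (b v / D) *\<^sub>R real_vec y"
  using D_ge_2 by (simp add: real_vec_eq_iff)

lemma cone_P_iff: "real_vec v \<in> cone_P x y \<longleftrightarrow> 0 < a v \<and> 0 < b v"
proof
  assume "real_vec v \<in> cone_P x y"
  then obtain \<alpha> \<beta> where *: "real_vec v = \<alpha> *\<^sub>R real_vec x + \<beta> *\<^sub>R real_vec y" "\<alpha> > 0" "\<beta> > 0"
    by (auto simp: cone_P_def)
  have "real_of_int (a v) > 0" "real_of_int (b v) > 0"
    using * D_ge_2 by (simp_all add: real_vec_eq_iff)
  then show "0 < a v \<and> 0 < b v" by simp
next
  assume "0 < a v \<and> 0 < b v"
  then show "real_vec v \<in> cone_P x y"
    unfolding cone_P_def using real_vec_expansion [of v] D_ge_2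
    by (intro CollectI exI [of _ "a v / D"] exI [of _ "b v / D"]) simp
qed

lemma cone_N_iff: "real_vec v \<in> cone_N x y \<longleftrightarrow> a v < 0 \<and> 0 < b v"
proof
  assume "real_vec v \<in> cone_N x y"
  then obtain \<alpha> \<beta> where *: "real_vec v = \<alpha> *\<^sub>R real_vec x + \<beta> *\<^sub>R real_vec y" "\<alpha> < 0" "\<beta> > 0"
    by (auto simp: cone_N_def)
  have "real_of_int (a v) < 0" "real_of_int (b v) > 0"
    using * D_ge_2 by (simp_all add: real_vec_eq_iff mult_less_0_iff)
  then show "a v < 0 \<and> 0 < b v" by simp
next
  assume "a v < 0 \<and> 0 < b v"
  then show "real_vec v \<in> cone_N x y"
    unfolding cone_N_def using real_vec_expansion [of v] D_ge_2
    by (intro CollectI exI [of _ "a v / D"] exI [of _ "b v / D"]) (simp add: divide_neg_pos)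
qed

text \<open>The determinant condition says that \<open>b c\<close> is 1 or -1, and positivity of the
  \<open>y\<close>-coordinate selects 1.\<close>

lemma start_candidates_iff: "c \<in> start_candidates x y \<longleftrightarrow> b c = 1"
proof
  assume "c \<in> start_candidates x y"
  then obtain \<alpha> \<beta> where *: "\<bar>det_cols x c\<bar> = 1"
    "real_vec c = \<alpha> *\<^sub>R real_vec x + \<beta> *\<^sub>R real_vec y" "\<beta> > 0"
    by (auto simp: start_candidates_def)
  have "real_of_int (b c) > 0"
    using * D_ge_2 by (simp add: real_vec_eq_iff)
  then show "b c = 1"
    using *(1) abs_b [of c] by simp
next
  assume "b c = 1"
  then show "c \<in> start_candidates x y"
    unfolding start_candidates_def using real_vec_expansion [of c] D_ge_2 abs_b [of c]
    by (intro CollectI conjI exI [of _ "a c / D"] exI [of _ "b c / D"]) simp_all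
qed

lemma eq_X_iff: "unimodular v \<Longrightarrow> cyclic_submodule v = X \<longleftrightarrow> b v = 0"
  using unimodular_parallel [OF unimodular_x] cyclic_submodule_eq_iff unimodular_x b_eq_0_iff
  by (metis coord_simps(6,10) cyclic_submodule_minus minus_minus neg_equal_0_iff_equal)

lemma eq_Y_iff: "unimodular v \<Longrightarrow> cyclic_submodule v = Y \<longleftrightarrow> a v = 0"
  using unimodular_parallel [OF _ unimodular_y] cyclic_submodule_eq_iff unimodular_y a_eq_0_iff
  by (metis coord_simps(5,11) neg_equal_0_iff_equal)

subsection \<open>The two cones\<close>

text \<open>The product \<open>a v * b v\<close> is the same for both generators of a point. The
  parameter \<tau>, equal to 1 or -1 in the applications, lets one argument serve both
  classes.\<close>

definition side :: "int \<Rightarrow> (int ^ 2) set set" where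
  "side \<tau> = {cyclic_submodule v | v. unimodular v \<and> 0 < \<tau> * (a v * b v)}"

lemma cyclic_submodule_in_side_iff:
  assumes "unimodular v"
  shows "cyclic_submodule v \<in> side \<tau> \<longleftrightarrow> 0 < \<tau> * (a v * b v)"
  using assms by (auto simp: side_def cyclic_submodule_eq_iff)

lemma mem_side_minus_one_iff:
  assumes "V \<in> proj_line - {X, Y}"
  shows "V \<in> side (-1) \<longleftrightarrow> V \<notin> side 1"
proof -
  obtain v where v: "unimodular v" "V = cyclic_submodule v"
    using assms proj_line_cases by auto
  then have "a v * b v \<noteq> 0"
    using assms by (auto simp: eq_X_iff eq_Y_iff)
  then have "0 < a v * b v \<or> a v * b v < 0"
    by linarith
  then show ?thesis
    using v by (auto simp: cyclic_submodule_in_side_iff)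
qed

lemma side_subset: "side \<tau> \<subseteq> proj_line - {X, Y}"
  by (auto simp: side_def eq_X_iff eq_Y_iff)

lemma cone_rel_iff:
  "(U, V) \<in> cone_rel X Y \<longleftrightarrow> U \<in> proj_line - {X, Y} \<and> V \<in> proj_line - {X, Y} \<and>
     (U \<in> side 1 \<longleftrightarrow> V \<in> side 1)"
proof (cases "U \<in> proj_line - {X, Y} \<and> V \<in> proj_line - {X, Y}")
  case True
  then obtain u v where u: "unimodular u" "U = cyclic_submodule u"
    and v: "unimodular v" "V = cyclic_submodule v"
    by (metis DiffD1 proj_line_cases)
  have nz: "a u \<noteq> 0" "b u \<noteq> 0" "a v \<noteq> 0" "b v \<noteq> 0"
    using True u v by (auto simp: eq_X_iff eq_Y_iff)
  have Dpos: "real_of_int D > 0" using D_ge_2 by simp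
  have side: "U \<in> side 1 \<longleftrightarrow> 0 < a u * b u" "V \<in> side 1 \<longleftrightarrow> 0 < a v * b v"
    using u v by (simp_all add: cyclic_submodule_in_side_iff)
  show ?thesis
  proof
    assume "(U, V) \<in> cone_rel X Y"
    then obtain x' y' u' v' \<alpha> \<beta> \<alpha>' \<beta>' where *:
      "x' \<in> reps X" "y' \<in> reps Y" "u' \<in> reps U" "v' \<in> reps V"
      "\<alpha> \<noteq> 0" "\<beta> \<noteq> 0" "\<alpha>' \<noteq> 0" "\<beta>' \<noteq> 0"
      "real_vec u' = \<alpha> *\<^sub>R real_vec x' + \<beta> *\<^sub>R real_vec y'"
      "real_vec v' = \<alpha>' *\<^sub>R real_vec x' + \<beta>' *\<^sub>R real_vec y'"
      "sgn (\<alpha> * \<beta>) = sgn (\<alpha>' * \<beta>')"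
      unfolding cone_rel_def mem_Collect_eq case_prod_conv by blast
    have neg: "real_vec (- w) = - real_vec w" for w
      by (simp add: real_vec_def vec_eq_iff)
    \<comment> \<open>The representatives supplied by the relation differ from \<open>x\<close> and
      \<open>y\<close> by signs \<open>s\<close> and \<open>t\<close>. Both coordinate products
      acquire the same factor \<open>s * t\<close>, so the comparison of their signs is
      unaffected.\<close>
    obtain s :: real where s: "s = 1 \<or> s = -1" "real_vec x' = s *\<^sub>R real_vec x"
      using *(1) unimodular_x that [of 1] that [of "-1"] by (auto simp: reps_cyclic_submodule neg)
    obtain t :: real where t: "t = 1 \<or> t = -1" "real_vec y' = t *\<^sub>R real_vec y"
      using *(2) unimodular_y that [of 1] that [of "-1"] by (auto simp: reps_cyclic_submodule neg)
    have "real_of_int (a u') = (\<alpha> * s) * D \<and> real_of_int (b u') = (\<beta> * t) * D"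
      "real_of_int (a v') = (\<alpha>' * s) * D \<and> real_of_int (b v') = (\<beta>' * t) * D"
      using *(9,10) s t by (simp_all flip: real_vec_eq_iff)
    then have "real_of_int (a u' * b u') = (s * t) * (\<alpha> * \<beta>) * (D * D)"
      "real_of_int (a v' * b v') = (s * t) * (\<alpha>' * \<beta>') * (D * D)"
      by simp_all
    then have "sgn (real_of_int (a u' * b u')) = sgn (real_of_int (a v' * b v'))"
      using *(11) by (simp only: sgn_mult)
    moreover have "a u' * b u' = a u * b u" "a v' * b v' = a v * b v"
      using *(3,4) u v by (auto simp: reps_cyclic_submodule)
    ultimately have "sgn (real_of_int (a u * b u)) = sgn (real_of_int (a v * b v))"
      by simp
    then have "0 < a u * b u \<longleftrightarrow> 0 < a v * b v"
      by (metis of_int_0_less_iff sgn_greater)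
    then show "U \<in> proj_line - {X, Y} \<and> V \<in> proj_line - {X, Y} \<and>
        (U \<in> side 1 \<longleftrightarrow> V \<in> side 1)"
      using True side by simp
  next
    assume "U \<in> proj_line - {X, Y} \<and> V \<in> proj_line - {X, Y} \<and> (U \<in> side 1 \<longleftrightarrow> V \<in> side 1)"
    then have "0 < a u * b u \<longleftrightarrow> 0 < a v * b v"
      using side by simp
    \<comment> \<open>Neither product is zero, so agreement about positivity is agreement of
      signs.\<close>
    then have "sgn (a u * b u) = sgn (a v * b v)"
      using nz by (simp add: sgn_if)
    then have sgn: "sgn (real_of_int (a u * b u)) = sgn (real_of_int (a v * b v))"
      by (auto simp: sgn_if split: if_splits simp del: of_int_mult)
    have "sgn ((real_of_int (a u) / D) * (b u / D)) = sgn ((real_of_int (a v) / D) * (b v / D))"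
      using sgn Dpos by (simp add: sgn_mult sgn_divide)
    moreover have "real_of_int (a u) / D \<noteq> 0" "real_of_int (b u) / D \<noteq> 0"
      "real_of_int (a v) / D \<noteq> 0" "real_of_int (b v) / D \<noteq> 0"
      using nz Dpos by simp_all
    moreover have "x \<in> reps X" "y \<in> reps Y" "u \<in> reps U" "v \<in> reps V"
      using u v unimodular_x unimodular_y by (simp_all add: mem_reps_iff)
    ultimately show "(U, V) \<in> cone_rel X Y"
      unfolding cone_rel_def mem_Collect_eq case_prod_conv
      using True real_vec_expansion [of u] real_vec_expansion [of v] by blast
  qed
next
  case False
  then show ?thesis
    unfolding cone_rel_def mem_Collect_eq case_prod_conv by argo
qed

lemma cone_rel_Image:
  assumes "\<sigma> = 1 \<or> \<sigma> = -1" "V \<in> side \<sigma>"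
  shows "cone_rel X Y `` {V} = side \<sigma>"
proof -
  have V: "V \<in> proj_line - {X, Y}"
    using assms(2) side_subset by blast
  have "(V, W) \<in> cone_rel X Y \<longleftrightarrow> W \<in> side \<sigma>" for W
  proof (cases "W \<in> proj_line - {X, Y}")
    case True
    then show ?thesis
      using assms V mem_side_minus_one_iff [OF True] mem_side_minus_one_iff [OF V]
      by (auto simp only: cone_rel_iff)
  next
    case False
    then show ?thesis
      using side_subset by (auto simp only: cone_rel_iff)
  qed
  then show ?thesis
    by blast
qed

text \<open>A quotient has only nonempty classes, so a witness on each side is required; the first
  entries of the two lists will provide them.\<close>

lemma cone_classes_eq:
  assumes "V \<in> side 1" "W \<in> side (-1)"
  shows "cone_classes X Y = {side 1, side (-1)}"
proof -
  have *: "U \<in> side 1 \<or> U \<in> side (-1)" if "U \<in> proj_line - {X, Y}" for U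
    using that mem_side_minus_one_iff by blast
  have "cone_classes X Y \<subseteq> {side 1, side (-1)}"
    using * cone_rel_Image unfolding cone_classes_def by (blast elim!: quotientE)
  moreover have "side \<sigma> \<in> cone_classes X Y" if "\<sigma> = 1 \<or> \<sigma> = -1" "U \<in> side \<sigma>" for U \<sigma>
  proof -
    have "U \<in> proj_line - {X, Y}"
      using that(2) side_subset by blast
    from quotientI [OF this, of "cone_rel X Y"] show ?thesis
      using cone_rel_Image [OF that] by (simp add: cone_classes_def)
  qed
  then have "side 1 \<in> cone_classes X Y" "side (-1) \<in> cone_classes X Y"
    using assms by blast+
  ultimately show ?thesis by blast
qed

end

text \<open>The convention \<open>exponent t w 0 = 1\<close> accounts for the initial list entry,
  and the block lengths add up to the number of \<open>t\<close>-steps. Thus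
  \<open>transition_Ar\<close> and \<open>transition_Bl\<close> become list lengths.\<close>

lemma exponent_sum_eq: "exponent_sum t w (num_blocks t w) = Suc (count_list w t)"
proof -
  have replicate: "count_list (replicate n s) t = (if s = t then n else 0)" for n s
    by (induction n) auto
  have blocks: "sum_list (block_lengths t w) = count_list w t"
  proof (induction w rule: blocks.induct)
    case (2 s w)
    have "count_list w t = count_list (takeWhile (\<lambda>b. b = s) w) t + count_list (dropWhile (\<lambda>b. b = s) w) t"
      by (metis count_list_append takeWhile_dropWhile_id)
    \<comment> \<open>The leading block is constant, so it contributes either its whole length or
      nothing.\<close>
    moreover have "takeWhile (\<lambda>b. b = s) w = replicate (length (takeWhile (\<lambda>b. b = s) w)) s"
      by (metis (mono_tags, lifting) replicate_eqI set_takeWhileD)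
    then have "count_list (takeWhile (\<lambda>b. b = s) w) t =
        (if s = t then length (takeWhile (\<lambda>b. b = s) w) else 0)"
      by (metis replicate)
    ultimately show ?case
      using 2 by (auto simp: block_lengths_def)
  qed (simp add: block_lengths_def)
  have "exponent_sum t w (num_blocks t w) =
      exponent t w 0 + (\<Sum>n = Suc 0..num_blocks t w. exponent t w n)"
    unfolding exponent_sum_def by (simp add: sum.atLeast_Suc_atMost)
  also have "(\<Sum>n = Suc 0..num_blocks t w. exponent t w n) = (\<Sum>n<num_blocks t w. exponent t w (Suc n))"
    by (simp add: sum.atLeast1_atMost_eq)
  also have "\<dots> = (\<Sum>n<num_blocks t w. block_lengths t w ! n)"
    by (intro sum.cong) (auto simp: exponent_def)
  also have "\<dots> = count_list w t"
    using blocks by (simp add: sum_list_sum_nth num_blocks_def lessThan_atLeast0)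
  finally show ?thesis
    by (simp add: exponent_def)
qed

context nonadjacent_pair
begin

subsection \<open>Shortest paths along a rail\<close>

text \<open>A rail is one of the two lists of the transition algorithm. The partner \<open>f\<close> of \<open>v\<close> in the
  other list gives the edge \<open>v\<close>, \<open>f\<close> that separates \<open>x\<close> from the successor \<open>v + f\<close>.\<close>

definition partner :: "int \<Rightarrow> int ^ 2 \<Rightarrow> int ^ 2 \<Rightarrow> bool" where
  "partner \<tau> v f \<longleftrightarrow> \<tau> * a f < 0 \<and> 0 < b f \<and> \<bar>det_cols v f\<bar> = 1"

definition rail :: "int \<Rightarrow> (int ^ 2) list \<Rightarrow> bool" where
  "rail \<tau> vs \<longleftrightarrow> vs \<noteq> [] \<and> \<bar>det_cols x (hd vs)\<bar> = 1 \<and>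
     (\<forall>v\<in>set vs. unimodular v \<and> 0 < \<tau> * a v \<and> 0 < b v) \<and>
     successively (\<lambda>v t. \<exists>f. partner \<tau> v f \<and> t = v + f) vs"

text \<open>Adding \<open>f\<close> keeps the determinant with \<open>last vs\<close>, so the sum is
  unimodular and adjacent to \<open>last vs\<close>. Its side is a hypothesis, since the sum of
  vectors from opposite sides may lie on either one.\<close>

lemma rail_snoc:
  assumes "rail \<tau> vs" "partner \<tau> (last vs) f" "0 < \<tau> * a (last vs + f)"
  shows "rail \<tau> (vs @ [last vs + f])"
proof -
  have "unimodular (last vs + f)"
    using assms(2) by (intro unimodular_if_abs_det_cols_eq_1 (2) [of "last vs"]) (simp add: partner_def)
  moreover have "0 < b (last vs + f)"
    using assms(1,2) by (auto simp: rail_def partner_def add_pos_pos)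
  ultimately show ?thesis
    using assms by (auto simp: rail_def successively_append_iff)
qed

text \<open>The edge \<open>v\<close>, \<open>f\<close> separates \<open>x\<close> from
  \<open>v + f\<close>, and the walk cannot use \<open>f\<close>, which lies on the opposite
  side.\<close>

lemma mem_set_if_partner:
  assumes "unimodular v" "0 < \<tau> * a v" "0 < b v" "partner \<tau> v f" "unimodular (v + f)"
    and p: "p \<noteq> []" "successively distant p" "set p \<subseteq> insert X (insert Y (side \<tau>))"
      "hd p = X" "last p = cyclic_submodule (v + f)"
  shows "cyclic_submodule v \<in> set p"
proof -
  have f: "\<tau> * a f < 0" "0 < b f" "\<bar>det_cols v f\<bar> = 1"
    using assms(4) by (auto simp: partner_def)
  have "unimodular f"
    using unimodular_if_abs_det_cols_eq_1 f by blast
  have "\<tau> * (a f * b f) < 0"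
    using f by (metis mult.assoc mult_neg_pos)
  then have "cyclic_submodule f \<notin> insert X (insert Y (side \<tau>))"
    using \<open>unimodular f\<close> f by (auto simp: eq_X_iff eq_Y_iff cyclic_submodule_in_side_iff)
  then have "cyclic_submodule f \<notin> set p"
    using p(3) by blast
  have "set p \<subseteq> proj_line"
    using p(3) side_subset unimodular_x unimodular_y by fastforce
  \<comment> \<open>The coordinates of \<open>x\<close> in the basis \<open>v\<close>,
    \<open>f\<close> are \<open>b f\<close> and \<open>- b v\<close> up to a common sign, and both
    \<open>b f\<close> and \<open>b v\<close> are positive.\<close>
  have "det_cols x f * det_cols v x = - (b f * b v)"
  proof -
    have "b f * b v = (sgn (det_cols x y) * sgn (det_cols x y)) * (det_cols x f * det_cols x v)"
      unfolding b_def by (simp only: mult_ac)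
    then show ?thesis using det_nz by (simp add: det_cols_swap [of v x])
  qed
  then have "det_cols x f * det_cols v x < 0"
    using f assms(3) by simp
  \<comment> \<open>Both factors equal \<open>det_cols v f\<close>.\<close>
  moreover have "0 < det_cols (v + f) f * det_cols v (v + f)"
    using f(3) by (auto simp: zero_less_mult_iff)
  ultimately have "cyclic_submodule v \<in> set p \<or> cyclic_submodule f \<in> set p"
    using walk_meets_separating_edge [OF f(3) unimodular_x _ assms(5) _ p(1) \<open>set p \<subseteq> proj_line\<close> p(2,4,5)]
    by blast
  then show ?thesis
    using \<open>cyclic_submodule f \<notin> set p\<close> by blast
qed

text \<open>Each point of \<open>L\<close> is forced on every walk within the class to its
  successor, so \<open>forced_walk\<close> gives both minimality and uniqueness.\<close>

lemma rail_shortest_path: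
  assumes rail: "rail \<tau> vs" and f: "partner \<tau> (last vs) f" "last vs + f = y"
  defines "L \<equiv> X # map cyclic_submodule vs @ [Y]"
  shows "L \<in> class_paths (side \<tau>) X Y"
    and "p \<in> class_paths (side \<tau>) X Y \<Longrightarrow> length L \<le> length p \<and> (length p = length L \<longrightarrow> p = L)"
proof -
  \<comment> \<open>Appending \<open>y\<close> makes the final edge a partner step like the
    others.\<close>
  define us where "us = vs @ [y]"
  have L: "L = map cyclic_submodule (x # us)"
    by (simp add: L_def us_def)
  have vs: "vs \<noteq> []" "\<bar>det_cols x (hd vs)\<bar> = 1"
    "\<And>v. v \<in> set vs \<Longrightarrow> unimodular v \<and> 0 < \<tau> * a v \<and> 0 < b v"
    using rail by (auto simp: rail_def)
  have succ: "successively (\<lambda>v t. \<exists>f. partner \<tau> v f \<and> t = v + f) us"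
    using rail f unfolding us_def rail_def by (auto simp: successively_append_iff)
  have us: "unimodular v" "0 < b v" if "v \<in> set us" for v
    using that vs(3) unimodular_y D_ge_2 by (auto simp: us_def)
  \<comment> \<open>Each step adds \<open>b f > 0\<close>; together with \<open>b x = 0\<close> this
    makes all vectors distinct.\<close>
  have "successively (\<lambda>v t. b v < b t) us"
    using succ by (rule successively_mono) (auto simp: partner_def)
  then have "sorted_wrt (\<lambda>v t. b v < b t) (x # us)"
    using us(2) by (auto simp: successively_conv_sorted_wrt transp_def)
  then have b_less: "b ((x # us) ! i) < b ((x # us) ! j)" if "i < j" "j < length (x # us)" for i j
    using that by (rule sorted_wrt_nth_less)
  have b_nonneg: "0 \<le> b v" if "v \<in> set (x # us)" for v
    using that us(2) less_imp_le by auto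
  have unim: "unimodular v" if "v \<in> set (x # us)" for v
    using that us(1) unimodular_x by auto
  \<comment> \<open>Opposite vectors cannot both occur: \<open>b\<close> is nonnegative on the list
    and vanishes only at \<open>x\<close>.\<close>
  have "inj_on cyclic_submodule (set (x # us))"
  proof (rule inj_onI)
    fix u v assume *: "u \<in> set (x # us)" "v \<in> set (x # us)" "cyclic_submodule u = cyclic_submodule v"
    then have "u = v \<or> u = - v"
      using unim cyclic_submodule_eq_iff by blast
    moreover have "u = v" if "u = - v"
    proof -
      have "b v = 0"
        using that b_nonneg [OF *(1)] b_nonneg [OF *(2)] by simp
      then have "v = x" "u = x"
        using * us(2) that by (fastforce, fastforce)
      then show ?thesis by simp
    qed
    ultimately show "u = v" by blast
  qed
  moreover have "distinct (x # us)"
    unfolding distinct_conv_nth by (metis b_less less_irrefl linorder_neq_iff)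
  ultimately have "distinct L"
    unfolding L distinct_map by blast
  have "successively (\<lambda>v t. \<bar>det_cols v t\<bar> = 1) us"
    using succ by (rule successively_mono) (auto simp: partner_def)
  then have "successively (\<lambda>v t. \<bar>det_cols v t\<bar> = 1) (x # us)"
    using vs(1,2) by (simp add: successively_Cons us_def)
  then have walk: "successively distant L"
    unfolding L successively_map
    by (rule successively_mono) (auto simp: distant_cyclic_submodule_iff unim)
  have sub: "set L - {X, Y} \<subseteq> side \<tau>"
  proof -
    have "cyclic_submodule v \<in> side \<tau>" if "v \<in> set vs" for v
      using vs(3) [OF that] by (simp add: cyclic_submodule_in_side_iff flip: mult.assoc)
    then show ?thesis
      unfolding L_def by auto
  qed
  have "set L \<subseteq> proj_line"
    using unim by (auto simp: L)
  then show "L \<in> class_paths (side \<tau>) X Y"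
    using walk sub \<open>distinct L\<close> by (auto simp: class_paths_iff L_def)
  show "length L \<le> length p \<and> (length p = length L \<longrightarrow> p = L)"
    if p: "p \<in> class_paths (side \<tau>) X Y"
  proof -
    \<comment> \<open>\<open>length us\<close> is the index of \<open>Y\<close> in \<open>L\<close>,
      and \<open>L\<close> has one more vertex than that.\<close>
    have "length us < length p \<and> (length p = Suc (length us) \<longrightarrow> p = take (Suc (length us)) L)"
    proof (rule forced_walk [OF _ \<open>distinct L\<close>])
      show "successively distant p" "set p \<subseteq> insert X (insert Y (side \<tau>))" "p \<noteq> []" "hd p = hd L"
        "last p = L ! length us" "length us < length L"
        using p by (auto simp: class_paths_iff L_def us_def nth_append)
    next
      fix i q
      assume i: "Suc i < length L" and q: "q \<noteq> []" "successively distant q"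
        "set q \<subseteq> insert X (insert Y (side \<tau>))" "hd q = hd L" "last q = L ! Suc i"
      show "L ! i \<in> set q"
      proof (cases i)
        case 0
        then show ?thesis using hd_in_set [OF q(1)] q(4) by (simp add: L_def)
      next
        case (Suc j)
        then have j: "Suc j < length us"
          using i by (simp add: L)
        then obtain g where g: "partner \<tau> (us ! j) g" "us ! Suc j = us ! j + g"
          using succ successively_nth by blast
        have "us ! j \<in> set vs"
          using j by (simp add: us_def nth_append)
        moreover have "unimodular (us ! j + g)"
          using us(1) j g(2) by (metis nth_mem)
        moreover have "last q = cyclic_submodule (us ! j + g)" "hd q = X"
          using q(4,5) Suc j g(2) by (simp_all add: L)
        ultimately have "cyclic_submodule (us ! j) \<in> set q"
          using vs(3) mem_set_if_partner [OF _ _ _ g(1) _ q(1-3)] by blast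
        then show ?thesis
          using Suc j by (simp add: L)
      qed
    qed
    then show ?thesis
      by (auto simp: L)
  qed
qed

subsection \<open>The transition algorithm\<close>

text \<open>The defining conditions reduce to \<open>b u = 1\<close> and \<open>0 < a u < D\<close>.
  Subtracting multiples of \<open>x\<close> fixes \<open>b\<close> and changes \<open>a\<close> by
  multiples of \<open>D\<close>, so \<open>u\<close> arises by reduction modulo
  \<open>D\<close>.\<close>

lemma start_u_props: "b (start_u x y) = 1" "0 < a (start_u x y)" "a (start_u x y) < D"
proof -
  obtain p q where pq: "p * x $ 1 + q * x $ 2 = 1"
    using bezout_int [of "x $ 1" "x $ 2"] unimodular_x by (auto simp: unimodular_def)
  \<comment> \<open>Bezout completes \<open>x\<close> to a basis; the sign makes \<open>b c\<close>
    equal to 1.\<close>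
  define c :: "int ^ 2" where "c = sgn (det_cols x y) *s vector [- q, p]"
  have "det_cols x (vector [- q, p]) = 1"
    using pq by (simp add: det_cols_eq algebra_simps)
  then have c: "b c = 1"
    unfolding c_def b_def using det_nz by simp
  define u where "u = c - (a c div D) *s x"
  have "b u = 1" "a u = a c mod D"
    using c by (simp_all add: u_def minus_div_mult_eq_mod)
  then have u: "b u = 1" "0 \<le> a u" "a u < D"
    using D_ge_2 by simp_all
  have "unimodular u"
    using u(1) abs_b [of u] by (intro unimodular_if_abs_det_cols_eq_1 (2) [of x]) simp
  have "a u \<noteq> 0"
  proof
    assume "a u = 0"
    then have "u = y \<or> u = - y"
      using unimodular_parallel [OF \<open>unimodular u\<close> unimodular_y] by (simp add: a_eq_0_iff)
    then show False
      using u(1) D_ge_2 by auto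
  qed
  have start: "v \<in> start_candidates x y \<and> v - x \<in> start_candidates x y \<and>
      real_vec v \<in> cone_P x y \<and> real_vec (v - x) \<in> cone_N x y \<longleftrightarrow> b v = 1 \<and> 0 < a v \<and> a v < D" for v
    by (auto simp: start_candidates_iff cone_P_iff cone_N_iff)
  have "start_u x y = u"
    unfolding start_u_def start
  proof (rule the_equality)
    show "b u = 1 \<and> 0 < a u \<and> a u < D"
      using u \<open>a u \<noteq> 0\<close> by simp
  next
    fix v assume v: "b v = 1 \<and> 0 < a v \<and> a v < D"
    have "unimodular v"
      using v abs_b [of v] by (intro unimodular_if_abs_det_cols_eq_1 (2) [of x]) simp
    \<comment> \<open>For two candidates with \<open>b\<close> equal to 1 the determinant identity
      gives their difference in \<open>a\<close>, so both \<open>a\<close>-values are the same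
      residue modulo \<open>D\<close>.\<close>
    have "D dvd a u - a v"
    proof -
      have "a u - a v = det_cols x y * det_cols u v"
        using coord_det [of u v] u v by simp
      then show ?thesis by (simp add: D_def)
    qed
    then have "a u mod D = a v mod D"
      by (simp add: mod_eq_dvd_iff)
    then have "a u = a v"
      using u v by simp
    then have "det_cols u v = 0"
      using coord_det [of u v] u v det_nz by simp
    then have "v = u \<or> v = - u"
      using unimodular_parallel [OF \<open>unimodular u\<close> \<open>unimodular v\<close>] by auto
    then show "v = u"
      using u v by auto
  qed
  then show "b (start_u x y) = 1" "0 < a (start_u x y)" "a (start_u x y) < D"
    using u \<open>a u \<noteq> 0\<close> by simp_all
qed

text \<open>The sign \<sigma> is 1 if the e-list runs in \<open>cone_P\<close> and -1 if it runs in
  \<open>cone_N\<close>. The heads are recorded to identify the classes of the first entries at the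
  end.\<close>

definition transition_inv :: "int \<Rightarrow> transition_state \<Rightarrow> bool" where
  "transition_inv \<sigma> = (\<lambda>(es, fs, w). rail \<sigma> es \<and> rail (- \<sigma>) fs \<and>
     \<bar>det_cols (last es) (last fs)\<bar> = 1 \<and> hd es = first_e x y \<and> hd fs = first_f x y \<and>
     length es = Suc (count_list w EStep) \<and> length fs = Suc (count_list w FStep))"

text \<open>If \<open>u + w = y\<close>, then \<open>cone_Qe\<close> defaults to
  \<open>cone_N\<close> although \<open>first_e\<close> is \<open>u\<close> in
  \<open>cone_P\<close>. Hence the last conclusion is conditional.\<close>

lemma transition_init:
  obtains \<sigma> where "\<sigma> = 1 \<or> \<sigma> = -1" "transition_inv \<sigma> ([first_e x y], [first_f x y], [])"
    "first_e x y + first_f x y \<noteq> y \<Longrightarrow>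
      cone_Qe x y = (if \<sigma> = 1 then cone_P x y else cone_N x y)"
proof -
  define u where "u = start_u x y"
  define w where "w = start_w x y"
  have w: "w = u - x"
    by (simp add: w_def u_def start_w_def)
  have bu: "b u = 1" "b w = 1" and au: "0 < a u" "a w < 0"
    using start_u_props by (simp_all add: w u_def)
  have det: "\<bar>det_cols x u\<bar> = 1" "\<bar>det_cols x w\<bar> = 1"
    using bu abs_b [of u] abs_b [of w] by simp_all
  have det_uw: "\<bar>det_cols u w\<bar> = 1" "\<bar>det_cols w u\<bar> = 1"
    using det abs_det_cols_swap [of x u] by (simp_all add: w)
  have unim: "unimodular u" "unimodular w"
    using det unimodular_if_abs_det_cols_eq_1 by blast+
  have disj: "real_vec u \<notin> cone_N x y" "real_vec u \<in> cone_P x y"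
    using au bu by (auto simp: cone_N_iff cone_P_iff)
  consider (P) "u + w = y \<or> cone_Qe x y = cone_P x y"
    | (N) "u + w \<noteq> y" "cone_Qe x y = cone_N x y"
    unfolding cone_Qe_def by argo
  then show thesis
  proof cases
    case P
    then have "first_e x y = u" "first_f x y = w"
      using disj by (auto simp: first_e_def first_f_def u_def w_def)
    then show thesis
      using P that [of 1] bu au unim det det_uw by (auto simp: transition_inv_def rail_def)
  next
    case N
    then have "first_e x y = w" "first_f x y = u"
      using disj by (auto simp: first_e_def first_f_def u_def w_def)
    then show thesis
      using N that [of "-1"] bu au unim det det_uw by (auto simp: transition_inv_def rail_def)
  qed
qed

lemma transition_inv_partner:
  assumes "transition_inv \<sigma> (es, fs, w)"
  shows "partner \<sigma> (last es) (last fs)" "partner (- \<sigma>) (last fs) (last es)"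
proof -
  have "\<And>v. v \<in> set es \<Longrightarrow> 0 < \<sigma> * a v \<and> 0 < b v" "es \<noteq> []"
    "\<And>v. v \<in> set fs \<Longrightarrow> 0 < - \<sigma> * a v \<and> 0 < b v" "fs \<noteq> []"
    "\<bar>det_cols (last es) (last fs)\<bar> = 1"
    using assms by (auto simp: transition_inv_def rail_def)
  then show "partner \<sigma> (last es) (last fs)" "partner (- \<sigma>) (last fs) (last es)"
    unfolding partner_def using last_in_set abs_det_cols_swap by fastforce+
qed

text \<open>Write \<open>e\<close>, \<open>f\<close> for the last entries. Since \<open>a e\<close>
  and \<open>a f\<close> are nonzero of opposite signs, the two terms of
  \<open>a e * b f - a f * b e\<close> add up in absolute value to at least
  \<open>b e + b f\<close>. The total is \<open>D\<close> because \<open>e\<close>, \<open>f\<close>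
  is a basis.\<close>

lemma transition_inv_b_le:
  assumes "transition_inv \<sigma> (es, fs, w)" "\<sigma> = 1 \<or> \<sigma> = -1"
  shows "b (last es) + b (last fs) \<le> D"
proof -
  define e where "e = last es"
  define f where "f = last fs"
  have *: "\<sigma> * a f < 0" "0 < \<sigma> * a e" "0 < b f" "0 < b e" "\<bar>det_cols e f\<bar> = 1"
    using transition_inv_partner [OF assms(1)] by (auto simp: partner_def e_def f_def)
  have "b f \<le> (\<sigma> * a e) * b f" "b e \<le> (- (\<sigma> * a f)) * b e"
    using * by (simp_all only: mult_le_cancel_right1) auto
  then have "b e + b f \<le> \<sigma> * (a e * b f - a f * b e)"
    by (simp add: algebra_simps)
  also have "\<dots> \<le> \<bar>a e * b f - a f * b e\<bar>"
    using assms(2) by auto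
  also have "\<dots> = D"
    using *(5) by (simp add: coord_det abs_mult D_def)
  finally show ?thesis
    by (simp add: e_def f_def)
qed

text \<open>The new vector \<open>s\<close> has \<open>b s > 0\<close>, so \<open>a s = 0\<close>
  would mean \<open>s = y\<close>. Otherwise \<open>s\<close> lies in exactly one of the two cones,
  and the second branch indeed extends the f-rail.\<close>

lemma transition_inv_step:
  assumes inv: "transition_inv \<sigma> (es, fs, w)" and \<sigma>: "\<sigma> = 1 \<or> \<sigma> = -1"
    and Qe: "cone_Qe x y = (if \<sigma> = 1 then cone_P x y else cone_N x y)"
    and ne: "last es + last fs \<noteq> y"
  shows "transition_inv \<sigma> (transition_step x y (es, fs, w))"
proof -
  define s where "s = last es + last fs"
  note partner = transition_inv_partner [OF inv]
  have det: "\<bar>det_cols (last es) s\<bar> = 1" "\<bar>det_cols s (last fs)\<bar> = 1"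
    using partner by (simp_all add: partner_def s_def)
  then have "unimodular s"
    using unimodular_if_abs_det_cols_eq_1 by blast
  have bs: "0 < b s"
    using partner by (simp add: partner_def s_def)
  have "a s \<noteq> 0"
  proof
    assume "a s = 0"
    then have "s = y \<or> s = - y"
      using unimodular_parallel [OF \<open>unimodular s\<close> unimodular_y] by (simp add: a_eq_0_iff)
    then show False
      using bs ne D_ge_2 by (auto simp: s_def)
  qed
  then have as: "0 < - \<sigma> * a s" if "\<not> 0 < \<sigma> * a s"
    using that \<sigma> by auto
  have in_Qe: "real_vec s \<in> cone_Qe x y \<longleftrightarrow> 0 < \<sigma> * a s"
    using \<sigma> bs unfolding Qe by (auto simp: cone_P_iff cone_N_iff)
  have rails: "rail \<sigma> es" "rail (- \<sigma>) fs"
    using inv by (auto simp: transition_inv_def)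
  show ?thesis
  proof (cases "0 < \<sigma> * a s")
    case True
    then have "rail \<sigma> (es @ [s])"
      using rail_snoc [OF rails(1) partner(1)] by (simp add: s_def)
    then show ?thesis
      using inv True in_Qe det unfolding transition_step_def s_def [symmetric]
      by (auto simp: transition_inv_def Let_def s_def [symmetric] rail_def)
  next
    case False
    then have "rail (- \<sigma>) (fs @ [s])"
      using as rail_snoc [OF rails(2) partner(2)] by (simp add: s_def add.commute)
    then show ?thesis
      using inv False in_Qe det unfolding transition_step_def s_def [symmetric]
      by (auto simp: transition_inv_def Let_def s_def [symmetric] rail_def)
  qed
qed

lemma transition_result:
  obtains \<sigma> es fs where "\<sigma> = 1 \<or> \<sigma> = -1" "rail \<sigma> es" "rail (- \<sigma>) fs"
    "partner \<sigma> (last es) (last fs)" "partner (- \<sigma>) (last fs) (last es)" "last es + last fs = y"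
    "hd es = first_e x y" "hd fs = first_f x y"
    "length es = transition_Ar x y" "length fs = transition_Bl x y"
proof -
  let ?init = "([first_e x y], [first_f x y], []) :: transition_state"
  obtain \<sigma> where \<sigma>: "\<sigma> = 1 \<or> \<sigma> = -1" and init: "transition_inv \<sigma> ?init"
    and Qe: "first_e x y + first_f x y \<noteq> y \<Longrightarrow>
      cone_Qe x y = (if \<sigma> = 1 then cone_P x y else cone_N x y)"
    using transition_init by blast
  \<comment> \<open>The disjunction remembers that the loop was entered, which makes the conditional
    fact about \<open>cone_Qe\<close> available.\<close>
  let ?P = "\<lambda>s. transition_inv \<sigma> s \<and> (s = ?init \<or> first_e x y + first_f x y \<noteq> y)"
  let ?c = "\<lambda>(es, fs, w :: step list). last es + last fs \<noteq> y"
  let ?m = "\<lambda>(es, fs, w :: step list). nat (D - b (last es) - b (last fs))"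
  have step: "?P (transition_step x y s)" if "?P s" "?c s" for s
  proof -
    obtain es fs w where s: "s = (es, fs, w)" by (cases s)
    have "first_e x y + first_f x y \<noteq> y"
      using that s by auto
    then show ?thesis
      using that s Qe transition_inv_step \<sigma> by auto
  qed
  have decr: "?m (transition_step x y s) < ?m s" if "?P s" "?c s" for s
  proof -
    obtain es fs w where s: "s = (es, fs, w)" by (cases s)
    obtain es' fs' w' where s': "transition_step x y s = (es', fs', w')"
      by (cases "transition_step x y s")
    have "transition_inv \<sigma> (es', fs', w')"
      using step [OF that] s' by simp
    then have "b (last es') + b (last fs') \<le> D"
      using transition_inv_b_le \<sigma> by blast
    moreover have "0 < b (last es)" "0 < b (last fs)"
      using transition_inv_partner [of \<sigma> es fs w] that s by (auto simp: partner_def)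
    then have "b (last es) + b (last fs) < b (last es') + b (last fs')"
      using s' unfolding s by (auto simp: transition_step_def Let_def split: if_splits)
    \<comment> \<open>The bound by \<open>D\<close> for the new state keeps truncation in
      \<open>nat\<close> from spoiling the strict decrease.\<close>
    ultimately show ?thesis
      unfolding s' by (simp add: s)
  qed
  obtain t where t: "while_option ?c (transition_step x y) ?init = Some t"
    using measure_while_option_Some [of ?P ?c "transition_step x y" ?m ?init] step decr init by blast
  obtain es fs w where t': "t = (es, fs, w)" by (cases t)
  have "transition_run x y = Some (es, fs, w)"
    unfolding transition_run_def using t t' by simp
  then have word: "transition_word x y = w"
    by (simp add: transition_word_def)
  have inv: "transition_inv \<sigma> (es, fs, w)"
    using while_option_rule [of ?P, OF step t] init t' by blast
  have "last es + last fs = y"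
    using while_option_stop [OF t] t' by simp
  moreover have "length es = transition_Ar x y" "length fs = transition_Bl x y"
    using inv by (simp_all add: transition_Ar_def transition_Bl_def word exponent_sum_eq
        transition_inv_def)
  ultimately show thesis
    using that [OF \<sigma>] inv transition_inv_partner [OF inv] by (auto simp: transition_inv_def)
qed

end

subsection \<open>Shortest paths in a union\<close>

text \<open>The number of edges is \<open>length p - 1\<close> with truncated subtraction, so
  nonemptiness is what lets equal walk lengths give equal list lengths.\<close>

lemma shortest_eq_singleton:
  assumes "L \<in> S" "\<And>p. p \<in> S \<Longrightarrow> p \<noteq> []"
    and "\<And>p. p \<in> S \<Longrightarrow> length L \<le> length p \<and> (length p = length L \<longrightarrow> p = L)"
  shows "shortest S = {L}" and "Inf (vwalk_length ` S) = vwalk_length L"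
proof -
  have le: "vwalk_length L \<le> vwalk_length p" if "p \<in> S" for p
    using assms(3) [OF that] by (simp add: diff_le_mono)
  have "p = L" if "p \<in> S" "vwalk_length p \<le> vwalk_length L" for p
    using that assms(1) assms(2,3) [of p] assms(2) [of L]
    by (cases p; cases L) auto
  then show "shortest S = {L}"
    using le assms(1) by (auto simp: shortest_def simp del: vwalk_length_simp)
  show "Inf (vwalk_length ` S) = vwalk_length L"
    using le assms(1) by (intro cInf_eq_minimum) (auto simp del: vwalk_length_simp)
qed

text \<open>A shortest member of the union is shortest in the set it comes from, so only
  \<open>p\<close> and \<open>q\<close> compete.\<close>

lemma shortest_Un:
  assumes "shortest S = {p}" "shortest T = {q}"
  shows "shortest (S \<union> T) =
    (if vwalk_length p < vwalk_length q then {p}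
     else if vwalk_length q < vwalk_length p then {q} else {p, q})"
proof -
  have p: "p \<in> S" "\<And>s. s \<in> S \<Longrightarrow> vwalk_length p \<le> vwalk_length s"
    "\<And>s. s \<in> S \<Longrightarrow> vwalk_length s \<le> vwalk_length p \<Longrightarrow> s = p"
    using assms(1) unfolding shortest_def by (blast, blast, blast intro: order_trans)
  have q: "q \<in> T" "\<And>s. s \<in> T \<Longrightarrow> vwalk_length q \<le> vwalk_length s"
    "\<And>s. s \<in> T \<Longrightarrow> vwalk_length s \<le> vwalk_length q \<Longrightarrow> s = q"
    using assms(2) unfolding shortest_def by (blast, blast, blast intro: order_trans)
  have "r \<in> shortest (S \<union> T) \<longleftrightarrow>
      r = p \<and> vwalk_length p \<le> vwalk_length q \<or> r = q \<and> vwalk_length q \<le> vwalk_length p" for r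
    unfolding shortest_def using p q by (blast intro: order_trans)
  then show ?thesis
    by (cases "vwalk_length p" "vwalk_length q" rule: linorder_cases)
      (simp_all add: set_eq_iff del: vwalk_length_simp)
qed

section \<open>Both cone classes together\<close>

context nonadjacent_pair
begin

lemma transition_paths:
  defines "E \<equiv> cyclic_submodule (first_e x y)" and "F \<equiv> cyclic_submodule (first_f x y)"
  defines "Ca \<equiv> cone_rel X Y `` {E}" and "Cb \<equiv> cone_rel X Y `` {F}"
  obtains p q where "cone_classes X Y = {Ca, Cb}" "E \<in> Ca" "F \<in> Cb" "Ca \<noteq> Cb" "p \<noteq> q"
    "shortest (class_paths Ca X Y) = {p}" "shortest (class_paths Cb X Y) = {q}"
    "vwalk_length p = class_dist Ca X Y" "vwalk_length q = class_dist Cb X Y"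
    "class_dist Ca X Y = 1 + transition_Ar x y" "class_dist Cb X Y = 1 + transition_Bl x y"
proof -
  obtain \<sigma> es fs where \<sigma>: "\<sigma> = 1 \<or> \<sigma> = -1" and rails: "rail \<sigma> es" "rail (- \<sigma>) fs"
    and partner: "partner \<sigma> (last es) (last fs)" "partner (- \<sigma>) (last fs) (last es)"
    and y: "last es + last fs = y"
    and hd: "hd es = first_e x y" "hd fs = first_f x y"
    and len: "length es = transition_Ar x y" "length fs = transition_Bl x y"
    using transition_result by blast
  have E: "E \<in> side \<sigma>"
    using rails(1) unfolding E_def hd(1) [symmetric]
    by (auto simp: rail_def cyclic_submodule_in_side_iff simp flip: mult.assoc)
  have F: "F \<in> side (- \<sigma>)"
    using rails(2) unfolding F_def hd(2) [symmetric]
    by (auto simp: rail_def cyclic_submodule_in_side_iff mult_less_0_iff simp flip: mult.assoc)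
  have "- \<sigma> = 1 \<or> - \<sigma> = -1"
    using \<sigma> by auto
  note Ca = cone_rel_Image [OF \<sigma> E, folded Ca_def]
    and Cb = cone_rel_Image [OF this F, folded Cb_def]
  have disj: "E \<notin> side (- \<sigma>)"
    using \<sigma> E side_subset mem_side_minus_one_iff by fastforce
  \<comment> \<open>With both end points, the path has \<open>length es + 1\<close> edges, which is
    the 1 in the distance formula.\<close>
  define p where "p = X # map cyclic_submodule es @ [Y]"
  define q where "q = X # map cyclic_submodule fs @ [Y]"
  note path = rail_shortest_path [OF rails(1) partner(1) y, folded p_def]
    rail_shortest_path [OF rails(2) partner(2) y [unfolded add.commute [of "last es"]], folded q_def]
  have nonempty: "r \<noteq> []" if "r \<in> class_paths C X Y" for r C
    using that by (simp add: class_paths_iff)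
  note p = shortest_eq_singleton [OF path(1) nonempty path(2), simplified Ca [symmetric] class_dist_def [symmetric]]
  note q = shortest_eq_singleton [OF path(3) nonempty path(4), simplified Cb [symmetric] class_dist_def [symmetric]]
  \<comment> \<open>The paths differ because \<open>E\<close> lies on \<open>p\<close>, while all
    inner vertices of \<open>q\<close> are on the other side.\<close>
  have "E \<in> set p"
    using rails(1) by (auto simp: p_def rail_def E_def simp flip: hd(1))
  moreover have "E \<notin> {X, Y}"
    using E side_subset by blast
  moreover have "set q - {X, Y} \<subseteq> side (- \<sigma>)"
    using path(3) by (simp only: class_paths_iff)
  ultimately have "p \<noteq> q"
    using disj by blast
  moreover have "cone_classes X Y = {Ca, Cb}"
    using \<sigma> E F cone_classes_eq unfolding Ca Cb by auto
  ultimately show thesis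
    using that [of p q] p q E F disj len unfolding Ca Cb by (auto simp: p_def q_def)
qed

end

section \<open>Connectedness and the count of shortest consistent paths\<close>

lemma reachable_distant_graph:
  assumes "U \<in> proj_line" "V \<in> proj_line"
  shows "U \<rightarrow>\<^sup>*\<^bsub>distant_graph\<^esub> V"
proof -
  interpret wf_digraph distant_graph
    by (rule wf_distant_graph)
  obtain u v where u: "unimodular u" "U = cyclic_submodule u"
    and v: "unimodular v" "V = cyclic_submodule v"
    using assms by (metis proj_line_cases)
  \<comment> \<open>Equal points, adjacent points, and pairs joined by a shortest path within a cone
    class.\<close>
  consider "\<bar>det_cols u v\<bar> = 0" | "\<bar>det_cols u v\<bar> = 1" | "2 \<le> \<bar>det_cols u v\<bar>"
    by linarith
  then show ?thesis
  proof cases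
    case 1
    then have "U = V"
      using u v unimodular_parallel [of u v] by (auto simp: cyclic_submodule_eq_iff)
    then show ?thesis
      using assms by simp
  next
    case 2
    then show ?thesis
      using assms u v by (intro reachable_adjI) (simp add: distant_cyclic_submodule_iff)
  next
    case 3
    then interpret nonadjacent_pair u v
      using u v by unfold_locales
    obtain C p where "shortest (class_paths C X Y) = {p}"
      using transition_paths by metis
    then have "p \<in> paths_between X Y"
      by (auto simp: shortest_def class_paths_def)
    then show ?thesis
      using u v unfolding reachable_vwalk_conv by (auto simp: paths_between_def vpath_def)
  qed
qed

theorem theorem1:
  shows
  "(\<forall>X\<in>proj_line. \<forall>Y\<in>proj_line. \<forall>x\<in>reps X. \<forall>y\<in>reps Y. X \<noteq> Y \<and> \<not> distant X Y \<longrightarrow>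
     (let E = cyclic_submodule (first_e x y);
          F = cyclic_submodule (first_f x y);
          Ca = cone_rel X Y `` {E};
          Cb = cone_rel X Y `` {F};
          da = class_dist Ca X Y;
          db = class_dist Cb X Y
      in
        (cone_classes X Y = {Ca, Cb} \<and> E \<in> Ca \<and> F \<in> Cb \<and> Ca \<noteq> Cb \<and>
         (\<forall>C\<in>cone_classes X Y. \<exists>!p. p \<in> shortest (class_paths C X Y)) \<and>
         (\<forall>p\<in>shortest (class_paths Ca X Y). vwalk_length p = da) \<and>
         (\<forall>p\<in>shortest (class_paths Cb X Y). vwalk_length p = db) \<and>
         da = 1 + transition_Ar x y \<and>
         db = 1 + transition_Bl x y) \<and>
        (finite (shortest (consistent_paths X Y)) \<and>
         card (shortest (consistent_paths X Y)) \<le> 2) \<and>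
        ((\<exists>!p. p \<in> shortest (consistent_paths X Y)) \<longleftrightarrow> da \<noteq> db)))
   \<and> Digraph_Component.connected distant_graph"
proof (intro conjI ballI impI)
  fix X Y x y
  assume x: "x \<in> reps X" and y: "y \<in> reps Y" and XY: "X \<noteq> Y \<and> \<not> distant X Y"
  have ux: "unimodular x" "X = cyclic_submodule x" and uy: "unimodular y" "Y = cyclic_submodule y"
    using x y by (simp_all add: mem_reps_iff)
  have "\<bar>det_cols x y\<bar> \<noteq> 0"
    using XY ux uy unimodular_parallel [of x y] by auto
  moreover have "\<bar>det_cols x y\<bar> \<noteq> 1"
    using XY ux uy by (simp add: distant_cyclic_submodule_iff)
  ultimately interpret nonadjacent_pair x y
    using ux uy by unfold_locales auto
  define Ca where "Ca = cone_rel X Y `` {cyclic_submodule (first_e x y)}"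
  define Cb where "Cb = cone_rel X Y `` {cyclic_submodule (first_f x y)}"
  obtain p q where classes: "cone_classes X Y = {Ca, Cb}"
    and mem: "cyclic_submodule (first_e x y) \<in> Ca" "cyclic_submodule (first_f x y) \<in> Cb" "Ca \<noteq> Cb"
    and pq: "p \<noteq> q" "shortest (class_paths Ca X Y) = {p}" "shortest (class_paths Cb X Y) = {q}"
    and len: "vwalk_length p = class_dist Ca X Y" "vwalk_length q = class_dist Cb X Y"
      "class_dist Ca X Y = 1 + transition_Ar x y" "class_dist Cb X Y = 1 + transition_Bl x y"
    using transition_paths unfolding Ca_def Cb_def ux(2) uy(2) by metis
  \<comment> \<open>There are only two classes, each with one shortest path, so the count depends on
    comparing two lengths.\<close>
  have "consistent_paths X Y = class_paths Ca X Y \<union> class_paths Cb X Y"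
    unfolding consistent_paths_def class_paths_def classes by blast
  then have shortest: "shortest (consistent_paths X Y) =
      (if class_dist Ca X Y < class_dist Cb X Y then {p}
       else if class_dist Cb X Y < class_dist Ca X Y then {q} else {p, q})"
    using shortest_Un [OF pq(2,3)] len by simp
  \<comment> \<open>In the case of a tie, \<open>p \<noteq> q\<close> makes the number of shortest
    paths exactly two.\<close>
  have "finite (shortest (consistent_paths X Y))" "card (shortest (consistent_paths X Y)) \<le> 2"
    using pq(1) unfolding shortest by simp_all
  moreover have "(\<exists>!p. p \<in> shortest (consistent_paths X Y)) \<longleftrightarrow> class_dist Ca X Y \<noteq> class_dist Cb X Y"
    using pq(1) unfolding shortest by auto
  moreover have "\<forall>C\<in>cone_classes X Y. \<exists>!p. p \<in> shortest (class_paths C X Y)"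
    unfolding classes using pq by simp
  ultimately show "let E = cyclic_submodule (first_e x y);
          F = cyclic_submodule (first_f x y);
          Ca = cone_rel X Y `` {E};
          Cb = cone_rel X Y `` {F};
          da = class_dist Ca X Y;
          db = class_dist Cb X Y
      in
        (cone_classes X Y = {Ca, Cb} \<and> E \<in> Ca \<and> F \<in> Cb \<and> Ca \<noteq> Cb \<and>
         (\<forall>C\<in>cone_classes X Y. \<exists>!p. p \<in> shortest (class_paths C X Y)) \<and>
         (\<forall>p\<in>shortest (class_paths Ca X Y). vwalk_length p = da) \<and>
         (\<forall>p\<in>shortest (class_paths Cb X Y). vwalk_length p = db) \<and>
         da = 1 + transition_Ar x y \<and>
         db = 1 + transition_Bl x y) \<and>
        (finite (shortest (consistent_paths X Y)) \<and>
         card (shortest (consistent_paths X Y)) \<le> 2) \<and>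
        ((\<exists>!p. p \<in> shortest (consistent_paths X Y)) \<longleftrightarrow> da \<noteq> db)"
    unfolding Let_def Ca_def [symmetric] Cb_def [symmetric]
    using classes mem pq(2,3) len by (simp del: vwalk_length_simp)
next
  interpret wf_digraph distant_graph
    by (rule wf_distant_graph)
  \<comment> \<open>Connectedness includes that there is a vertex.\<close>
  have "unimodular (vector [1, 0])"
    by (simp add: unimodular_def)
  then have "proj_line \<noteq> {}"
    by (auto simp: proj_line_def)
  then show "Digraph_Component.connected distant_graph"
    using reachable_distant_graph
    by (intro connectedI) (auto intro: reachable_mk_symmetricI)
qed

end
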